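(* Let $0<q<p\le1$, $k\in\mathbb{Z}$ and $n\ge1$. Then $$E_{n,p,q}^{(k)}(x)=\sum_{l=0}^\infty \frac{1}{[l+1]_{p,q}^k}\sum_{j=0}^{l+1}\binom{l+1}{j}(-1)^jE_n(x-j),$$ where $E_n(x)$ are the classical Euler polynomials.
   Context: $[n]_{p,q}=\frac{p^n-q^n}{p-q}$; $\mathrm{Li}_{k,p,q}(t)=\sum_{n\ge1} t^n/[n]_{p,q}^k$. The $(p,q)$-poly-Euler polynomials are defined by $\frac{2\,\mathrm{Li}_{k,p,q}(1-e^{-t})}{1+e^{t}}e^{xt}=\sum_{n\ge0} E_{n,p,q}^{(k)}(x)\frac{t^n}{n!}$. The Euler polynomials are defined by $\frac{2e^{xt}}{e^t+1}=\sum_{n\ge0}E_n(x)\frac{t^n}{n!}$. *)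

theory Defs
  imports Complex_Main "HOL-Computational_Algebra.Formal_Power_Series"
begin

definition pq_number :: "real \<Rightarrow> real \<Rightarrow> nat \<Rightarrow> real" where
  "pq_number p q n = (p ^ n - q ^ n) / (p - q)"

text \<open>
  Generating functions are formal power series in \<open>t\<close>, for a fixed evaluation point \<open>x\<close>
  in an arbitrary real normed field (in particular real or complex). The polylogarithm has zero
  constant term, as does \<open>1 - e\<^sup>-\<^sup>t\<close>, so the composition below is the genuine
  substitution; \<open>1 + e\<^sup>t\<close> has constant term 2, so the quotients are genuine as well.
\<close>

definition pq_polylog :: "int \<Rightarrow> real \<Rightarrow> real \<Rightarrow> 'a :: real_normed_field fps" where
  "pq_polylog k p q =
     Abs_fps (\<lambda>n. if n = 0 then 0 else 1 / of_real (pq_number p q n) powi k)"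

definition pq_poly_euler_gf ::
    "int \<Rightarrow> real \<Rightarrow> real \<Rightarrow> 'a :: real_normed_field \<Rightarrow> 'a fps" where
  "pq_poly_euler_gf k p q x =
     (2 * fps_compose (pq_polylog k p q) (1 - fps_exp (- 1))) / (1 + fps_exp 1) * fps_exp x"

definition pq_poly_euler ::
    "int \<Rightarrow> real \<Rightarrow> real \<Rightarrow> nat \<Rightarrow> 'a :: real_normed_field \<Rightarrow> 'a" where
  "pq_poly_euler k p q n x = fact n * fps_nth (pq_poly_euler_gf k p q x) n"

definition euler_gf :: "'a :: real_normed_field \<Rightarrow> 'a fps" where
  "euler_gf x = 2 * fps_exp x / (fps_exp 1 + 1)"

definition euler_poly :: "nat \<Rightarrow> 'a :: real_normed_field \<Rightarrow> 'a" where
  "euler_poly n x = fact n * fps_nth (euler_gf x) n"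

lemma pq_poly_euler_egf:
  "pq_poly_euler_gf k p q x = Abs_fps (\<lambda>n. pq_poly_euler k p q n x / fact n)"
  by (simp add: fps_eq_iff pq_poly_euler_def)

lemma euler_poly_egf: "euler_gf x = Abs_fps (\<lambda>n. euler_poly n x / fact n)"
  by (simp add: fps_eq_iff euler_poly_def)

lemma pq_poly_euler_gf_mult:
  "pq_poly_euler_gf k p q x * (1 + fps_exp 1) =
     2 * fps_compose (pq_polylog k p q) (1 - fps_exp (- 1)) * fps_exp x"
proof -
  have "fps_nth (1 + fps_exp (1 :: 'a)) 0 \<noteq> 0" by simp
  then show ?thesis
    by (simp add: pq_poly_euler_gf_def fps_divide_unit inverse_mult_eq_1' mult_ac)
qed

lemma euler_gf_mult: "euler_gf x * (fps_exp 1 + 1) = 2 * fps_exp x"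
proof -
  have "fps_nth (fps_exp (1 :: 'a) + 1) 0 \<noteq> 0" by simp
  then show ?thesis
    by (simp add: euler_gf_def fps_divide_unit inverse_mult_eq_1' mult_ac)
qed

end

theory Submission imports Defs begin

text \<open>
  Put \<open>u = 1 - e\<^sup>-\<^sup>t\<close>. Multiplication by \<open>e\<^sup>-\<^sup>t\<close> shifts the argument of the Euler generating
  function by one, so the inner binomial sum is \<open>n!\<close> times the coefficient of \<open>t\<^sup>n\<close> in
  \<open>u\<^sup>l\<^sup>+\<^sup>1\<close> times that generating function. As \<open>u\<close> has order 1, this vanishes for \<open>l \<ge> n\<close>:
  the series terminates, and for formal reasons it computes the coefficients of
  \<open>Li(u)\<close> times the Euler generating function.
\<close>

unbundle fps_syntax

lemma fps_mult_power_nth_eq_0: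
  fixes u b :: "'a :: idom fps"
  assumes "u $ 0 = 0" and "n < i"
  shows "(u ^ i * b) $ n = 0"
  unfolding fps_mult_nth
  using assms by (intro sum.neutral) (auto simp: startsby_zero_power_prefix)

text \<open>Since \<open>u ^ i\<close> has no terms below degree \<open>i\<close>, all coefficients
  of \<open>a oo u\<close> up to degree \<open>n\<close> can be summed over the same range
  \<open>0..n\<close>. This bound, independent of \<open>m\<close>, lets the sum over
  \<open>i\<close> be exchanged with the convolution.\<close>

lemma fps_compose_mult_nth:
  fixes a b u :: "'a :: idom fps"
  assumes "u $ 0 = 0"
  shows "((a oo u) * b) $ n = (\<Sum>i = 0..n. a $ i * (u ^ i * b) $ n)"
proof -
  have compose: "(a oo u) $ m = (\<Sum>i = 0..n. a $ i * (u ^ i) $ m)" if "m \<le> n" for m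
    unfolding fps_compose_nth
    using that assms by (intro sum.mono_neutral_left) (auto simp: startsby_zero_power_prefix)
  have "((a oo u) * b) $ n = (\<Sum>m = 0..n. \<Sum>i = 0..n. a $ i * ((u ^ i) $ m * b $ (n - m)))"
    unfolding fps_mult_nth
    by (intro sum.cong) (auto simp: compose sum_distrib_right mult.assoc)
  also have "\<dots> = (\<Sum>i = 0..n. a $ i * (u ^ i * b) $ n)"
    by (subst sum.swap) (simp add: fps_mult_nth sum_distrib_left)
  finally show ?thesis .
qed

lemma euler_gf_diff_of_nat:
  "euler_gf (x - of_nat j) = fps_exp (- 1) ^ j * euler_gf (x :: 'a :: real_normed_field)"
proof -
  have "fps_exp (x - of_nat j) = fps_exp (- 1) ^ j * fps_exp x"
    by (simp add: fps_exp_power_mult fps_exp_add_mult [symmetric])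
  moreover have "fps_nth (fps_exp 1 + 1 :: 'a fps) 0 \<noteq> 0" by simp
  ultimately show ?thesis
    by (simp add: euler_gf_def fps_divide_unit mult_ac)
qed

lemma binomial_sum_euler_poly:
  fixes x :: "'a :: real_normed_field"
  shows "(\<Sum>j = 0..m. of_nat (m choose j) * (- 1) ^ j * euler_poly n (x - of_nat j)) =
    fact n * ((1 - fps_exp (- 1)) ^ m * euler_gf x) $ n"
proof -
  let ?e = "fps_exp (- 1) :: 'a fps"
  \<comment> \<open>With \<open>- ?e\<close> as the first summand, the binomial theorem puts the
    exponent \<open>j\<close> on it.\<close>
  have "(1 - ?e) ^ m = (- ?e + 1) ^ m" by simp
  also have "\<dots> = (\<Sum>j\<le>m. of_nat (m choose j) * (- ?e) ^ j)"
    by (subst binomial_ring) simp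
  also have "\<dots> = (\<Sum>j = 0..m. fps_const (of_nat (m choose j) * (- 1) ^ j) * ?e ^ j)"
    unfolding atMost_atLeast0
  proof (intro sum.cong refl)
    fix j
    have "(- ?e) ^ j = (- 1) ^ j * ?e ^ j" by (rule power_minus)
    \<comment> \<open>The sign becomes a constant series, so that each summand is a scalar multiple
      of a shifted Euler generating function and its coefficients can be read off.\<close>
    moreover have "(- 1 :: 'a fps) ^ j = fps_const ((- 1) ^ j)"
      by (metis fps_const_1_eq_1 fps_const_neg fps_const_power)
    ultimately show "of_nat (m choose j) * (- ?e) ^ j =
        fps_const (of_nat (m choose j) * (- 1) ^ j) * ?e ^ j"
      by (simp add: fps_of_nat [symmetric] mult.assoc flip: fps_const_mult)
  qed
  finally have "(1 - ?e) ^ m * euler_gf x =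
      (\<Sum>j = 0..m. fps_const (of_nat (m choose j) * (- 1) ^ j) * euler_gf (x - of_nat j))"
    by (simp add: sum_distrib_right euler_gf_diff_of_nat mult.assoc)
  then show ?thesis
    by (simp add: fps_sum_nth sum_distrib_left euler_poly_def mult_ac)
qed

lemma pq_poly_euler_gf_eq:
  "pq_poly_euler_gf k p q (x :: 'a :: real_normed_field) =
    (pq_polylog k p q oo (1 - fps_exp (- 1))) * euler_gf x"
proof -
  have "fps_nth (fps_exp 1 + 1 :: 'a fps) 0 \<noteq> 0" by simp
  then show ?thesis
    by (simp add: pq_poly_euler_gf_def euler_gf_def fps_divide_unit add.commute mult_ac)
qed

theorem theorem2:
  fixes p q :: real and k :: int and n :: nat and x :: "'a :: real_normed_field"
  assumes "0 < q" and "q < p" and "p \<le> 1" and "n \<ge> 1"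
  shows "(\<lambda>l. 1 / of_real (pq_number p q (l + 1)) powi k *
            (\<Sum>j = 0..l + 1. of_nat ((l + 1) choose j) * (- 1) ^ j * euler_poly n (x - of_nat j)))
         sums pq_poly_euler k p q n x"
proof -
  let ?u = "1 - fps_exp (- 1) :: 'a fps"
  let ?L = "pq_polylog k p q :: 'a fps"
  let ?f = "\<lambda>l. 1 / of_real (pq_number p q (l + 1)) powi k *
    (\<Sum>j = 0..l + 1. of_nat ((l + 1) choose j) * (- 1) ^ j * euler_poly n (x - of_nat j))"
  have f: "?f l = fact n * (?L $ Suc l * (?u ^ Suc l * euler_gf x) $ n)" for l
    unfolding binomial_sum_euler_poly by (simp add: pq_polylog_def)
  have u0: "?u $ 0 = 0" by simp
  have "?f sums (\<Sum>l<n. ?f l)"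
  proof (rule sums_finite)
    fix l assume "l \<notin> {..<n}"
    then have "(?u ^ Suc l * euler_gf x) $ n = 0"
      by (intro fps_mult_power_nth_eq_0 u0) simp
    then show "?f l = 0" unfolding f by simp
  qed simp
  \<comment> \<open>Reindexing by \<open>i = Suc l\<close> leaves room for a term at
    \<open>i = 0\<close>; it is zero because the polylogarithm has zero constant term. The range is
    then \<open>0..n\<close>, as in the coefficient formula for the composition.\<close>
  also have "(\<Sum>l<n. ?f l) = fact n * (\<Sum>i<Suc n. ?L $ i * (?u ^ i * euler_gf x) $ n)"
    unfolding f sum_distrib_left [symmetric] sum.lessThan_Suc_shift
    by (simp add: pq_polylog_def)
  also have "\<dots> = pq_poly_euler k p q n x"
    by (simp only: pq_poly_euler_def pq_poly_euler_gf_eq fps_compose_mult_nth [OF u0]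
        lessThan_Suc_atMost atMost_atLeast0)
  finally show ?thesis .
qed

end
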